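(* Let $\Pi=\mathbb{R}/\mathbb{Z}$ be the circle, let $a\in C^2(\Pi)$ with $a>0$, and for a probability measure $\mu$ on $\Pi$ set $$I_1(\mu):=\sup_{u\in C^2(\Pi),\,u>0}\;-\int_\Pi a(x)\,\frac{u''(x)}{u(x)}\,d\mu(x).$$ If $\mu$ is a probability measure on $\Pi$ possessing an isolated atom, then $I_1(\mu)=+\infty$.
   Context: An isolated atom of $\mu$ is a point $x_0\in\Pi$ with $\mu(\{x_0\})>0$ such that $\mu(B(x_0,r)\setminus\{x_0\})=0$ for some $r>0$, where $B(x_0,r)$ is the ball of radius $r$ about $x_0$. *)

theory Defs
  imports "HOL-Probability.Probability"
begin

text \<open>The circle \<open>\<real>/\<int>\<close>, with the quotient metric (distance to the nearest integer of the
  difference of two representatives).\<close>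

quotient_type circle = real / "\<lambda>x y. x - y \<in> \<int>"
  morphisms rep_circle to_circle
proof (rule equivpI)
  show "reflp (\<lambda>x y::real. x - y \<in> \<int>)"
    by (simp add: reflp_def)
  show "symp (\<lambda>x y::real. x - y \<in> \<int>)"
    by (auto simp: symp_def dest: Ints_minus)
  show "transp (\<lambda>x y::real. x - y \<in> \<int>)"
  proof (rule transpI)
    fix x y z :: real
    assume "x - y \<in> \<int>" "y - z \<in> \<int>"
    then have "(x - y) + (y - z) \<in> \<int>" by (rule Ints_add)
    then show "x - z \<in> \<int>" by simp
  qed
qed

lemma infdist_Ints_cong:
  fixes s t :: real
  assumes "s - t \<in> \<int>"
  shows "infdist s \<int> = infdist t \<int>"
proof -
  have le: "infdist u \<int> \<le> infdist v \<int>" if d: "u - v \<in> \<int>" for u v :: real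
  proof -
    have "(\<int>::real set) \<noteq> {}" using Ints_0 by blast
    then obtain n :: real where n: "n \<in> \<int>" "infdist v \<int> = dist v n"
      using infdist_attains_inf[OF closed_Ints] by blast
    have "infdist u \<int> \<le> dist u (n + (u - v))"
      by (intro infdist_le Ints_add n d)
    also have "\<dots> = dist v n" by (simp add: dist_real_def)
    finally show ?thesis using n by simp
  qed
  have "t - s \<in> \<int>" using Ints_minus[OF assms] by simp
  then show ?thesis using le[OF assms] le[of t s] by simp
qed

lemma infdist_Ints_triangle:
  "infdist (s + t) (\<int>::real set) \<le> infdist s \<int> + infdist t \<int>"
proof -
  have ne: "(\<int>::real set) \<noteq> {}" using Ints_0 by blast
  obtain m :: real where m: "m \<in> \<int>" "infdist s \<int> = dist s m"
    using infdist_attains_inf[OF closed_Ints ne] by blast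
  obtain n :: real where n: "n \<in> \<int>" "infdist t \<int> = dist t n"
    using infdist_attains_inf[OF closed_Ints ne] by blast
  have "infdist (s + t) \<int> \<le> dist (s + t) (m + n)"
    by (intro infdist_le Ints_add m n)
  also have "\<dots> \<le> dist s m + dist t n" by (simp add: dist_real_def)
  finally show ?thesis using m n by simp
qed

lemma infdist_Ints_uminus: "infdist (- t) (\<int>::real set) = infdist t \<int>"
proof -
  have le: "infdist (- u) \<int> \<le> infdist u (\<int>::real set)" for u :: real
  proof -
    have "(\<int>::real set) \<noteq> {}" using Ints_0 by blast
    then obtain n :: real where n: "n \<in> \<int>" "infdist u \<int> = dist u n"
      using infdist_attains_inf[OF closed_Ints] by blast
    have "infdist (- u) \<int> \<le> dist (- u) (- n)"
      by (intro infdist_le Ints_minus n)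
    also have "\<dots> = dist u n" by (simp add: dist_real_def)
    finally show ?thesis using n by simp
  qed
  show ?thesis using le[of t] le[of "- t"] by simp
qed

instantiation circle :: metric_space
begin

lift_definition dist_circle :: "circle \<Rightarrow> circle \<Rightarrow> real" is "\<lambda>x y. infdist (x - y) \<int>"
proof -
  fix x x' y y' :: real
  assume "x - x' \<in> \<int>" "y - y' \<in> \<int>"
  then have "(x - x') - (y - y') \<in> \<int>" by (rule Ints_diff)
  then show "infdist (x - y) \<int> = infdist (x' - y') \<int>"
    by (intro infdist_Ints_cong) (simp add: algebra_simps)
qed

definition uniformity_circle :: "(circle \<times> circle) filter" where
  "uniformity_circle = (INF e\<in>{0 <..}. principal {(x, y). dist x y < e})"

definition open_circle :: "circle set \<Rightarrow> bool" where
  "open_circle U \<longleftrightarrow> (\<forall>x\<in>U. eventually (\<lambda>(x', y). x' = x \<longrightarrow> y \<in> U) uniformity)"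

instance
proof
  show "dist x y = 0 \<longleftrightarrow> x = y" for x y :: circle
  proof transfer
    have "(\<int>::real set) \<noteq> {}" using Ints_0 by blast
    then show "(infdist (x - y) \<int> = 0) = (x - y \<in> \<int>)" for x y :: real
      using in_closed_iff_infdist_zero[OF closed_Ints] by blast
  qed
  show "dist x y \<le> dist x z + dist y z" for x y z :: circle
  proof transfer
    fix x y z :: real
    have "infdist ((x - z) + - (y - z)) \<int> \<le> infdist (x - z) \<int> + infdist (- (y - z)) \<int>"
      by (rule infdist_Ints_triangle)
    then show "infdist (x - y) \<int> \<le> infdist (x - z) \<int> + infdist (y - z) \<int>"
      unfolding infdist_Ints_uminus by simp
  qed
qed (fact uniformity_circle_def open_circle_def)+

end

text \<open>\<open>t \<mapsto> f (to_circle t)\<close> is the 1-periodic function on the line that corresponds to \<open>f\<close>;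
  its derivative is again 1-periodic and descends to the circle. As with \<^const>\<open>deriv\<close>, the value
  is arbitrary where \<open>f\<close> is not differentiable.\<close>

lift_definition circle_deriv :: "(circle \<Rightarrow> real) \<Rightarrow> circle \<Rightarrow> real" is
  "\<lambda>f t. deriv (\<lambda>s. f (to_circle s)) t"
proof -
  fix f :: "circle \<Rightarrow> real" and x y :: real
  assume xy: "x - y \<in> \<int>"
  have per: "to_circle (s + (x - y)) = to_circle s" for s
    using xy by (simp add: circle.abs_eq_iff)
  have "((\<lambda>s. f (to_circle s)) has_field_derivative D) (at x) \<longleftrightarrow>
        ((\<lambda>s. f (to_circle s)) has_field_derivative D) (at y)" for D
    using DERIV_shift[of "\<lambda>s. f (to_circle s)" D y "x - y"] by (simp add: per)
  then show "deriv (\<lambda>s. f (to_circle s)) x = deriv (\<lambda>s. f (to_circle s)) y"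
    by (simp add: deriv_def)
qed

definition circle_differentiable :: "(circle \<Rightarrow> real) \<Rightarrow> bool" where
  "circle_differentiable f \<longleftrightarrow> (\<forall>t. (\<lambda>s. f (to_circle s)) differentiable (at t))"

definition C2_circle :: "(circle \<Rightarrow> real) set" where
  "C2_circle = {f. circle_differentiable f \<and> circle_differentiable (circle_deriv f) \<and>
     continuous_on UNIV (circle_deriv (circle_deriv f))}"

definition isolated_atom :: "circle measure \<Rightarrow> circle \<Rightarrow> bool" where
  "isolated_atom \<mu> x0 \<longleftrightarrow>
     measure \<mu> {x0} > 0 \<and> (\<exists>r>0. measure \<mu> (ball x0 r - {x0}) = 0)"

definition I1 :: "(circle \<Rightarrow> real) \<Rightarrow> circle measure \<Rightarrow> ereal" where
  "I1 a \<mu> = (SUP u \<in> {u \<in> C2_circle. \<forall>x. u x > 0}.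
     ereal (- (\<integral>x. a x * (circle_deriv (circle_deriv u) x / u x) \<partial>\<mu>)))"

end

theory Submission
  imports Defs
begin

text \<open>Perturb the constant function \<open>1\<close> by a \<open>C\<^sup>2\<close> bump of height one that is supported in a
  shrinking neighbourhood of the atom \<open>x0\<close>. Off \<open>x0\<close> the quotient \<open>u'' / u\<close> is zero
  \<open>\<mu>\<close>-almost everywhere, while at \<open>x0\<close> it tends to \<open>-\<infinity>\<close>. The bump is
  \<open>(max 0 w)\<^sup>3\<close> with \<open>w = (cos (2 * pi * (x - x0)) - 1 + d) / d\<close> and \<open>d \<rightarrow> 0\<close>, which is periodic
  without any gluing.\<close>

section \<open>Calculus on the circle through real representatives\<close>

lemma to_circle_cases:
  obtains t where "x = to_circle t"
  by (induction x rule: circle.abs_induct) blast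

lemma to_circle_add_Int: "n \<in> \<int> \<Longrightarrow> to_circle (t + n) = to_circle t"
  by (simp add: circle.abs_eq_iff)

text \<open>Close points of the circle have close representatives, so a modulus of continuity at a
  representative \<open>s\<close> also serves at the point \<open>to_circle s\<close>.\<close>

lemma continuous_on_circleI:
  fixes f :: "circle \<Rightarrow> 'a::metric_space"
  assumes "continuous_on UNIV (\<lambda>t. f (to_circle t))"
  shows "continuous_on UNIV f"
proof -
  have "\<exists>d>0. \<forall>y. dist y x < d \<longrightarrow> dist (f y) (f x) < e" if "e > 0" for x e
  proof -
    obtain s where s: "x = to_circle s" by (rule to_circle_cases)
    obtain d where d: "d > 0" "\<And>t. dist t s < d \<Longrightarrow> dist (f (to_circle t)) (f (to_circle s)) < e"
      using assms \<open>e > 0\<close> unfolding continuous_on_iff by (metis UNIV_I)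
    have "dist (f y) (f x) < e" if y: "dist y x < d" for y
    proof -
      obtain t where t: "y = to_circle t" by (rule to_circle_cases)
      have "(\<int>::real set) \<noteq> {}" using Ints_0 by blast
      then obtain n :: real where n: "n \<in> \<int>" "infdist (t - s) \<int> = dist (t - s) n"
        using infdist_attains_inf[OF closed_Ints] by blast
      \<comment> \<open>Shifting \<open>t\<close> by the integer \<open>n\<close> nearest to
        \<open>t - s\<close> turns the circle distance into a distance of reals.\<close>
      have "dist (t + - n) s < d"
        using y n(2) by (simp add: t s dist_circle.abs_eq dist_real_def algebra_simps)
      from d(2)[OF this] show ?thesis
        using to_circle_add_Int[of "- n" t] n(1) by (simp add: s t)
    qed
    with d(1) show ?thesis by blast
  qed
  then show ?thesis by (simp add: continuous_on_iff)
qed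

lemma circle_differentiable_continuous_on:
  assumes "circle_differentiable f"
  shows "continuous_on UNIV f"
  using assms
  by (intro continuous_on_circleI)
    (simp add: circle_differentiable_def continuous_at_imp_continuous_on
      differentiable_imp_continuous_within)

text \<open>Reduces all differentiation on the circle to ordinary derivatives along the line,
  provided that the candidate derivative is itself given as a function on the circle.\<close>

lemma
  assumes "\<And>t. ((\<lambda>s. f (to_circle s)) has_real_derivative g (to_circle t)) (at t)"
  shows circle_differentiableI: "circle_differentiable f"
    and circle_deriv_eqI: "circle_deriv f = g"
proof -
  show "circle_differentiable f"
    using assms by (auto simp: circle_differentiable_def real_differentiable_def)
  show "circle_deriv f = g"
  proof
    fix x
    obtain t where "x = to_circle t" by (rule to_circle_cases)
    then show "circle_deriv f x = g x"
      using DERIV_imp_deriv[OF assms] by (simp add: circle_deriv.abs_eq)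
  qed
qed

text \<open>With exponent at least 2, the power flattens the kink of \<open>max 0 x\<close> at the
  origin. Away from 0 the function agrees locally with 0 or with a monomial.\<close>

lemma has_real_derivative_max_0_power:
  "((\<lambda>x. max 0 x ^ Suc (Suc n)) has_real_derivative real (n + 2) * max 0 x ^ Suc n) (at x)"
proof -
  consider "x < 0" | "x = 0" | "x > 0" by linarith
  then show ?thesis
  proof cases
    case 1
    have "((\<lambda>_. 0) has_real_derivative 0) (at x)" by simp
    then have "((\<lambda>x. max 0 x ^ Suc (Suc n)) has_real_derivative 0) (at x)"
      by (rule has_field_derivative_transform_within_open[where S = "{..<0}"]) (use 1 in auto)
    then show ?thesis using 1 by simp
  next
    case 2
    have "isCont (\<lambda>z::real. max 0 z ^ Suc n) 0" by (intro continuous_intros)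
    \<comment> \<open>The Caratheodory slope at 0: \<open>max 0 z ^ Suc (Suc n)\<close> is
      \<open>max 0 z ^ Suc n\<close> times \<open>z\<close>, for either sign of \<open>z\<close>,
      and this slope vanishes at 0.\<close>
    then show ?thesis
      unfolding 2 DERIV_caratheodory_within
      by (intro exI[of _ "\<lambda>z. max 0 z ^ Suc n"]) (auto simp: max_def)
  next
    case 3
    have "((\<lambda>x. x ^ Suc (Suc n)) has_real_derivative real (n + 2) * x ^ Suc n) (at x)"
      using DERIV_pow[of "Suc (Suc n)" x] by simp
    then have "((\<lambda>x. max 0 x ^ Suc (Suc n)) has_real_derivative real (n + 2) * x ^ Suc n) (at x)"
      by (rule has_field_derivative_transform_within_open[where S = "{0<..}"]) (use 3 in auto)
    then show ?thesis using 3 by simp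
  qed
qed

lemma DERIV_max_0_square: "((\<lambda>x. (max 0 x)\<^sup>2) has_real_derivative 2 * max 0 x) (at x)"
  using has_real_derivative_max_0_power[of 0] by (simp add: eval_nat_numeral)

lemma DERIV_max_0_cube: "((\<lambda>x. max 0 x ^ 3) has_real_derivative 3 * (max 0 x)\<^sup>2) (at x)"
  using has_real_derivative_max_0_power[of 1] by (simp add: eval_nat_numeral)

section \<open>Cosine and sine of the displacement from a base point\<close>

lemma
  fixes s t s' t' :: real
  assumes "s - s' \<in> \<int>" "t - t' \<in> \<int>"
  shows cos_2pi_cong_Ints: "cos (2 * pi * (t - s)) = cos (2 * pi * (t' - s'))"
    and sin_2pi_cong_Ints: "sin (2 * pi * (t - s)) = sin (2 * pi * (t' - s'))"
proof -
  from Ints_diff[OF assms(2,1)] obtain n where "t - t' - (s - s') = of_int n"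
    by (auto elim: Ints_cases)
  then have "t - s = t' - s' + of_int n" by simp
  then have *: "2 * pi * (t - s) = 2 * pi * (t' - s') + 2 * pi * of_int n"
    by (simp only: distrib_left)
  show "cos (2 * pi * (t - s)) = cos (2 * pi * (t' - s'))"
    "sin (2 * pi * (t - s)) = sin (2 * pi * (t' - s'))"
    unfolding * by (simp_all add: cos_add sin_add)
qed

text \<open>By periodicity and evenness, \<open>s\<close> may be replaced by its distance
  \<open>e\<close> to the nearest integer. This lies in the interval from 0 to 1/2, where
  \<open>cos (2 * pi * e)\<close> is decreasing.\<close>

lemma cos_2pi_le_of_infdist_Ints:
  fixes s :: real
  assumes "0 \<le> r" "r \<le> infdist s \<int>"
  shows "cos (2 * pi * s) \<le> cos (2 * pi * r)"
proof -
  define e where "e = \<bar>s - of_int (round s)\<bar>"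
  have e: "r \<le> e" "e \<le> 1 / 2"
    using assms(2) infdist_le[OF Ints_of_int, of s "round s"] of_int_round_abs_le[of s]
    by (auto simp: e_def dist_real_def abs_minus_commute)
  have "cos (2 * pi * s) = cos (2 * pi * (s - of_int (round s)))"
    using cos_2pi_cong_Ints[of 0 "of_int (round s)" s s] by simp
  also have "\<dots> = cos (2 * pi * e)"
    by (simp add: e_def abs_if) (metis cos_minus minus_diff_eq mult_minus_right)
  also have "\<dots> \<le> cos (2 * pi * r)"
    using e assms(1) by (intro cos_monotone_0_pi_le) auto
  finally show ?thesis .
qed

lift_definition circle_cos :: "circle \<Rightarrow> circle \<Rightarrow> real" is "\<lambda>s t. cos (2 * pi * (t - s))"
  by (rule cos_2pi_cong_Ints)

lift_definition circle_sin :: "circle \<Rightarrow> circle \<Rightarrow> real" is "\<lambda>s t. sin (2 * pi * (t - s))"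
  by (rule sin_2pi_cong_Ints)

lemma circle_cos_self [simp]: "circle_cos x x = 1"
  by transfer simp

lemma circle_sin_self [simp]: "circle_sin x x = 0"
  by transfer simp

text \<open>Turns a lower bound on the distance from \<open>x0\<close> into an upper bound on the
  cosine, which is what confines the bump to a ball.\<close>

lemma circle_cos_le:
  assumes "0 \<le> r" "r \<le> dist x x0"
  shows "circle_cos x0 x \<le> cos (2 * pi * r)"
  using assms by transfer (rule cos_2pi_le_of_infdist_Ints)

lemma DERIV_circle_cos:
  "((\<lambda>s. circle_cos x (to_circle s)) has_real_derivative
    - (2 * pi * circle_sin x (to_circle t))) (at t)"
proof -
  obtain z where "x = to_circle z" by (rule to_circle_cases)
  then show ?thesis
    by (auto simp: circle_cos.abs_eq circle_sin.abs_eq intro!: derivative_eq_intros)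
qed

lemma DERIV_circle_sin:
  "((\<lambda>s. circle_sin x (to_circle s)) has_real_derivative
    2 * pi * circle_cos x (to_circle t)) (at t)"
proof -
  obtain z where "x = to_circle z" by (rule to_circle_cases)
  then show ?thesis
    by (auto simp: circle_cos.abs_eq circle_sin.abs_eq intro!: derivative_eq_intros)
qed

lemma continuous_on_circle_cos [continuous_intros]: "continuous_on UNIV (circle_cos x)"
  by (rule circle_differentiable_continuous_on circle_differentiableI DERIV_circle_cos)+

lemma continuous_on_circle_sin [continuous_intros]: "continuous_on UNIV (circle_sin x)"
  by (rule circle_differentiable_continuous_on circle_differentiableI DERIV_circle_sin)+

section \<open>The bump and its first two derivatives\<close>

definition cap :: "circle \<Rightarrow> real \<Rightarrow> circle \<Rightarrow> real" where
  "cap x0 d x = (circle_cos x0 x - 1 + d) / d"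

text \<open>The cube makes the second derivative continuous across the zeros of \<open>cap\<close>;
  a square would in general leave a jump there. The summand 1 ensures positivity.\<close>

definition bump :: "circle \<Rightarrow> real \<Rightarrow> circle \<Rightarrow> real" where
  "bump x0 d x = 1 + max 0 (cap x0 d x) ^ 3"

definition bump' :: "circle \<Rightarrow> real \<Rightarrow> circle \<Rightarrow> real" where
  "bump' x0 d x = 3 * (max 0 (cap x0 d x))\<^sup>2 * (- (2 * pi * circle_sin x0 x) / d)"

definition bump'' :: "circle \<Rightarrow> real \<Rightarrow> circle \<Rightarrow> real" where
  "bump'' x0 d x = 6 * max 0 (cap x0 d x) * (2 * pi * circle_sin x0 x / d)\<^sup>2
    - 3 * (max 0 (cap x0 d x))\<^sup>2 * ((2 * pi)\<^sup>2 * circle_cos x0 x / d)"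

lemma DERIV_cap:
  "((\<lambda>s. cap x0 d (to_circle s)) has_real_derivative
    - (2 * pi * circle_sin x0 (to_circle t)) / d) (at t)"
  unfolding cap_def
  by (rule DERIV_cdivide, rule DERIV_cong)
    (rule DERIV_add DERIV_diff DERIV_circle_cos DERIV_const | simp)+

lemma DERIV_bump:
  "((\<lambda>s. bump x0 d (to_circle s)) has_real_derivative bump' x0 d (to_circle t)) (at t)"
  using DERIV_add[OF DERIV_const[of 1] DERIV_chain2[OF DERIV_max_0_cube DERIV_cap]]
  by (simp add: bump_def bump'_def)

lemma DERIV_bump':
  "((\<lambda>s. bump' x0 d (to_circle s)) has_real_derivative bump'' x0 d (to_circle t)) (at t)"
proof -
  have "((\<lambda>s. 3 * (max 0 (cap x0 d (to_circle s)))\<^sup>2) has_real_derivative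
      3 * (2 * max 0 (cap x0 d (to_circle t)) * (- (2 * pi * circle_sin x0 (to_circle t)) / d))) (at t)"
    by (intro DERIV_cmult DERIV_chain2[OF DERIV_max_0_square DERIV_cap])
  moreover have "((\<lambda>s. - (2 * pi * circle_sin x0 (to_circle s)) / d) has_real_derivative
      - (2 * pi * (2 * pi * circle_cos x0 (to_circle t))) / d) (at t)"
    by (intro DERIV_cdivide DERIV_minus DERIV_cmult DERIV_circle_sin)
  ultimately show ?thesis
    unfolding bump'_def
    by (rule DERIV_cong[OF DERIV_mult])
      (simp add: bump''_def divide_inverse power2_eq_square algebra_simps)
qed

lemma bump_pos: "bump x0 d x > 0"
  by (simp add: bump_def add_pos_nonneg)

lemma continuous_on_bump'': "continuous_on UNIV (bump'' x0 d)"
  unfolding bump''_def cap_def divide_inverse by (intro continuous_intros)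

lemma circle_deriv_bump [simp]: "circle_deriv (bump x0 d) = bump' x0 d"
  by (rule circle_deriv_eqI DERIV_bump)+

lemma circle_deriv_bump' [simp]: "circle_deriv (bump' x0 d) = bump'' x0 d"
  by (rule circle_deriv_eqI DERIV_bump')+

lemma bump_C2: "bump x0 d \<in> C2_circle"
  by (simp add: C2_circle_def circle_differentiableI[OF DERIV_bump]
      circle_differentiableI[OF DERIV_bump'] continuous_on_bump'')

lemma bump_self: "d \<noteq> 0 \<Longrightarrow> bump x0 d x0 = 2"
  by (simp add: bump_def cap_def)

text \<open>At \<open>x0\<close> the sine vanishes and \<open>cap\<close> equals 1, so only the
  cosine term survives. It is unbounded below as \<open>d\<close> decreases to 0.\<close>

lemma bump''_self: "d \<noteq> 0 \<Longrightarrow> bump'' x0 d x0 = - 12 * pi\<^sup>2 / d"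
  by (simp add: bump''_def cap_def)

lemma bump''_eq_0:
  assumes "d > 0" "circle_cos x0 x \<le> 1 - d"
  shows "bump'' x0 d x = 0"
proof -
  have "cap x0 d x \<le> 0" using assms by (simp add: cap_def divide_le_0_iff)
  then show ?thesis by (simp add: bump''_def)
qed

text \<open>The punctured ball is a null set and \<open>bump''\<close> vanishes outside the ball, so
  only the atom contributes, with the quotient \<open>- 12 * pi\<^sup>2 / d\<close> over 2.\<close>

lemma integral_bump:
  assumes a: "continuous_on UNIV a" and fin: "finite_measure \<mu>" and sets: "sets \<mu> = sets borel"
    and null: "measure \<mu> (ball x0 r - {x0}) = 0"
    and d: "d > 0" and cos: "\<And>x. r \<le> dist x x0 \<Longrightarrow> circle_cos x0 x \<le> 1 - d"
  shows "(\<integral>x. a x * (bump'' x0 d x / bump x0 d x) \<partial>\<mu>) = - (6 * pi\<^sup>2 * a x0 * measure \<mu> {x0} / d)"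
proof -
  interpret finite_measure \<mu> by fact
  let ?f = "\<lambda>x. a x * (bump'' x0 d x / bump x0 d x)"
  have "continuous_on UNIV (bump x0 d)"
    by (intro circle_differentiable_continuous_on circle_differentiableI[OF DERIV_bump])
  \<comment> \<open>Continuity is shown for the sake of Borel measurability, which the
    almost-everywhere replacement of the integrand requires.\<close>
  then have "continuous_on UNIV ?f"
    using a continuous_on_bump'' bump_pos by (intro continuous_intros) (auto simp: less_imp_neq[symmetric])
  then have f: "?f \<in> borel_measurable \<mu>"
    using borel_measurable_continuous_onI measurable_cong_sets[OF sets refl] by blast
  have "ball x0 r - {x0} \<in> sets \<mu>" unfolding sets by simp
  then have "ball x0 r - {x0} \<in> null_sets \<mu>"
    using null by (simp add: null_sets_def emeasure_eq_measure)
  then have "AE x in \<mu>. x \<notin> ball x0 r - {x0}" by (rule AE_not_in)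
  then have "AE x in \<mu>. ?f x = indicator {x0} x * ?f x0"
    by eventually_elim
      (auto simp: indicator_def dist_commute not_less intro!: bump''_eq_0 d cos)
  moreover have "{x0} \<in> sets \<mu>" unfolding sets by simp
  ultimately have "integral\<^sup>L \<mu> ?f = (\<integral>x. indicator {x0} x * ?f x0 \<partial>\<mu>)"
    using f by (intro integral_cong_AE) auto
  also have "\<dots> = measure \<mu> {x0} * ?f x0"
    using \<open>{x0} \<in> sets \<mu>\<close> sets_eq_imp_space_eq[OF sets] by simp
  also have "\<dots> = - (6 * pi\<^sup>2 * a x0 * measure \<mu> {x0} / d)"
    using d by (simp add: bump_self bump''_self)
  finally show ?thesis .
qed

theorem proposition2p3:
  fixes a :: "circle \<Rightarrow> real" and \<mu> :: "circle measure"
  assumes "a \<in> C2_circle" and "\<forall>x. a x > 0"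
    and "prob_space \<mu>" and "sets \<mu> = sets borel"
    and "\<exists>x0. isolated_atom \<mu> x0"
  shows "I1 a \<mu> = \<infinity>"
proof -
  interpret prob_space \<mu> by fact
  obtain x0 r where m: "measure \<mu> {x0} > 0" and r: "r > 0"
    and null: "measure \<mu> (ball x0 r - {x0}) = 0"
    using assms(5) by (auto simp: isolated_atom_def)
  have a: "continuous_on UNIV a"
    using assms(1) by (auto simp: C2_circle_def intro: circle_differentiable_continuous_on)
  \<comment> \<open>Distances on the circle never exceed 1/2. For larger \<open>r\<close> the angle
    \<open>2 * pi * r\<close> would leave the range where cosine decreases, and its cosine could
    even return to 1.\<close>
  define q where "q = min r (1 / 2)"
  define c where "c = cos (2 * pi * q)"
  have q: "0 < q" "q \<le> r" "q \<le> 1 / 2" using r by (auto simp: q_def)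
  have "c < 1"
    using cos_monotone_0_pi[of 0 "2 * pi * q"] q by (simp add: c_def)
  have c: "circle_cos x0 x \<le> c" if "r \<le> dist x x0" for x
    unfolding c_def using that q by (intro circle_cos_le) auto
  define k where "k = 6 * pi\<^sup>2 * a x0 * measure \<mu> {x0}"
  have "k > 0" using assms(2) m by (simp add: k_def)
  have "\<exists>u \<in> {u \<in> C2_circle. \<forall>x. u x > 0}. ereal (real n) \<le>
      ereal (- (\<integral>x. a x * (circle_deriv (circle_deriv u) x / u x) \<partial>\<mu>))" for n
  proof
    \<comment> \<open>The first bound keeps the bump inside the ball of radius \<open>r\<close>; the
      second makes \<open>k / d\<close> at least \<open>n + 1\<close>. Adding 1 avoids dividing by 0
      when \<open>n\<close> is 0.\<close>
    define d where "d = min (1 - c) (k / (real n + 1))"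
    have d: "d > 0" "d \<le> 1 - c" "d \<le> k / (real n + 1)"
      using \<open>k > 0\<close> \<open>c < 1\<close> by (auto simp: d_def)
    have "circle_cos x0 x \<le> 1 - d" if "r \<le> dist x x0" for x
      using c[OF that] d(2) by simp
    from integral_bump[OF a finite_measure_axioms assms(4) null d(1) this]
    have "(\<integral>x. a x * (bump'' x0 d x / bump x0 d x) \<partial>\<mu>) = - (k / d)"
      by (simp add: k_def)
    moreover have "real n \<le> k / d"
      using d(1,3) by (simp add: field_simps)
    ultimately show "ereal (real n) \<le>
      ereal (- (\<integral>x. a x * (circle_deriv (circle_deriv (bump x0 d)) x / bump x0 d x) \<partial>\<mu>))"
      by simp
    show "bump x0 d \<in> {u \<in> C2_circle. \<forall>x. u x > 0}"
      by (simp add: bump_C2 bump_pos)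
  qed
  then show ?thesis unfolding I1_def by (rule SUP_PInfty)
qed

end
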